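(* Let $k$ be an algebraically closed field of prime characteristic $p$. Let $L$ be a finite group such that $p$ divides the order of $L$, and let $\alpha\in Z^2(L,k^{\times})$ be a (normalized) $2$-cocycle, where $L$ acts trivially on $k^\times$. If $L_{C(p)}\cap L_{\alpha}^{\circ}\neq\emptyset$, then $\mathrm{HH}^1(k_{\alpha}L)\neq 0$.
   Context: $Z^2(L,k^\times)$ (trivial action of $L$ on the multiplicative group $k^\times$) is the set of maps $\alpha:L\times L\to k^\times$ with $\alpha(xy,z)\alpha(x,y)=\alpha(x,yz)\alpha(y,z)$ for all $x,y,z\in L$; $\alpha$ is normalized if $\alpha(1,1)=1$. The twisted group algebra $k_\alpha L$ is the $k$-algebra with $k$-basis indexed by the elements of $L$ and multiplication given on basis elements by $x\cdot y=\alpha(x,y)\,xy$. An element $x\in L$ is $\alpha$-regular if $\alpha(x,y)=\alpha(y,x)$ for all $y\in C_L(x)$; $L_\alpha^\circ$ denotes the set of $\alpha$-regular elements of $L$. $L_{C(p)}$ denotes the set of all $x\in L$ such that $p$ divides the index $|C_L(x):(C_L(x))'|$, where $C_L(x)$ is the centralizer of $x$ in $L$ and $H'$ denotes the commutator subgroup of $H$. $\mathrm{HH}^1(A)$ denotes the first Hochschild cohomology of a $k$-algebra $A$, i.e. the space of $k$-linear derivations of $A$ modulo inner derivations. *)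

theory Defs
  imports "HOL-Algebra.Algebra" "HOL-Computational_Algebra.Primes"
begin

text \<open>The order of an element of infinite order is 0 in HOL-Algebra, so this follows the usual
  convention for characteristic 0.\<close>

definition ring_characteristic :: "('k, 'm) ring_scheme \<Rightarrow> nat" where
  "ring_characteristic R = group.ord (add_monoid R) \<one>\<^bsub>R\<^esub>"

definition centralizer :: "('g, 'n) monoid_scheme \<Rightarrow> 'g \<Rightarrow> 'g set" where
  "centralizer L x = {y \<in> carrier L. x \<otimes>\<^bsub>L\<^esub> y = y \<otimes>\<^bsub>L\<^esub> x}"

definition abelianization_index :: "('g, 'n) monoid_scheme \<Rightarrow> 'g set \<Rightarrow> nat" where
  "abelianization_index L H = card (rcosets\<^bsub>L\<lparr>carrier := H\<rparr>\<^esub> (derived L H))"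

definition centralizer_p_elements :: "('g, 'n) monoid_scheme \<Rightarrow> nat \<Rightarrow> 'g set" where
  "centralizer_p_elements L p =
     {x \<in> carrier L. p dvd abelianization_index L (centralizer L x)}"

text \<open>The second argument is the coefficient group, with trivial action of the first.
  As with \<open>hom\<close>, values outside the carriers are irrelevant and left unconstrained.\<close>

definition two_cocycles ::
    "('g, 'n) monoid_scheme \<Rightarrow> ('a, 'm) monoid_scheme \<Rightarrow> ('g \<Rightarrow> 'g \<Rightarrow> 'a) set" where
  "two_cocycles L M =
     {\<alpha> \<in> carrier L \<rightarrow> carrier L \<rightarrow> carrier M.
        \<forall>x \<in> carrier L. \<forall>y \<in> carrier L. \<forall>z \<in> carrier L.
          \<alpha> (x \<otimes>\<^bsub>L\<^esub> y) z \<otimes>\<^bsub>M\<^esub> \<alpha> x y = \<alpha> x (y \<otimes>\<^bsub>L\<^esub> z) \<otimes>\<^bsub>M\<^esub> \<alpha> y z}"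

definition normalized_cocycle ::
    "('g, 'n) monoid_scheme \<Rightarrow> ('a, 'm) monoid_scheme \<Rightarrow> ('g \<Rightarrow> 'g \<Rightarrow> 'a) \<Rightarrow> bool" where
  "normalized_cocycle L M \<alpha> \<longleftrightarrow> \<alpha> \<one>\<^bsub>L\<^esub> \<one>\<^bsub>L\<^esub> = \<one>\<^bsub>M\<^esub>"

definition regular_elements ::
    "('g, 'n) monoid_scheme \<Rightarrow> ('g \<Rightarrow> 'g \<Rightarrow> 'a) \<Rightarrow> 'g set" where
  "regular_elements L \<alpha> = {x \<in> carrier L. \<forall>y \<in> centralizer L x. \<alpha> x y = \<alpha> y x}"

text \<open>An element is represented by its coefficient function on \<open>L\<close>; the basis element of \<open>x\<close> is
  the indicator function of \<open>x\<close>. The product extends the twisted product of basis elements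
  bilinearly: the pairs \<open>(x, y)\<close> with product \<open>z\<close> are those with \<open>y = x\<^sup>-\<^sup>1z\<close>. The unit is
  \<open>\<alpha>(1,1)\<^sup>-\<^sup>1\<close> times the basis element of 1, for normalized \<open>\<alpha>\<close> just that basis element.\<close>

definition twisted_group_algebra ::
    "('k, 'm) ring_scheme \<Rightarrow> ('g, 'n) monoid_scheme \<Rightarrow> ('g \<Rightarrow> 'g \<Rightarrow> 'k) \<Rightarrow> ('k, 'g \<Rightarrow> 'k) module"
  where
  "twisted_group_algebra k L \<alpha> =
     \<lparr>carrier = carrier L \<rightarrow>\<^sub>E carrier k,
      monoid.mult = (\<lambda>a b. \<lambda>z \<in> carrier L. \<Oplus>\<^bsub>k\<^esub>x \<in> carrier L.
                \<alpha> x (inv\<^bsub>L\<^esub> x \<otimes>\<^bsub>L\<^esub> z) \<otimes>\<^bsub>k\<^esub> (a x \<otimes>\<^bsub>k\<^esub> b (inv\<^bsub>L\<^esub> x \<otimes>\<^bsub>L\<^esub> z))),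
      monoid.one = (\<lambda>z \<in> carrier L. if z = \<one>\<^bsub>L\<^esub> then inv\<^bsub>k\<^esub> (\<alpha> \<one>\<^bsub>L\<^esub> \<one>\<^bsub>L\<^esub>) else \<zero>\<^bsub>k\<^esub>),
      ring.zero = (\<lambda>z \<in> carrier L. \<zero>\<^bsub>k\<^esub>),
      ring.add = (\<lambda>a b. \<lambda>z \<in> carrier L. a z \<oplus>\<^bsub>k\<^esub> b z),
      smult = (\<lambda>c a. \<lambda>z \<in> carrier L. c \<otimes>\<^bsub>k\<^esub> a z)\<rparr>"

definition basis_element ::
    "('k, 'm) ring_scheme \<Rightarrow> ('g, 'n) monoid_scheme \<Rightarrow> 'g \<Rightarrow> 'g \<Rightarrow> 'k" where
  "basis_element k L x = (\<lambda>z \<in> carrier L. if z = x then \<one>\<^bsub>k\<^esub> else \<zero>\<^bsub>k\<^esub>)"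

lemma basis_element_mult:
  fixes k :: "('k, 'm) ring_scheme" and L :: "('g, 'n) monoid_scheme"
  assumes "field k" "group L" "finite (carrier L)"
    and \<alpha>: "\<alpha> \<in> two_cocycles L (units_of k)"
    and x: "x \<in> carrier L" and y: "y \<in> carrier L"
  defines "A \<equiv> twisted_group_algebra k L \<alpha>"
  shows "basis_element k L x \<otimes>\<^bsub>A\<^esub> basis_element k L y =
           \<alpha> x y \<odot>\<^bsub>A\<^esub> basis_element k L (x \<otimes>\<^bsub>L\<^esub> y)"
proof -
  interpret k: field k by fact
  interpret L: group L by fact
  have \<alpha>_closed: "\<alpha> u v \<in> carrier k" if "u \<in> carrier L" "v \<in> carrier L" for u v
    using \<alpha> that k.Units_closed unfolding two_cocycles_def units_of_def by fastforce
  have "(\<Oplus>\<^bsub>k\<^esub>u \<in> carrier L. \<alpha> u (inv\<^bsub>L\<^esub> u \<otimes>\<^bsub>L\<^esub> z) \<otimes>\<^bsub>k\<^esub>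
            (basis_element k L x u \<otimes>\<^bsub>k\<^esub> basis_element k L y (inv\<^bsub>L\<^esub> u \<otimes>\<^bsub>L\<^esub> z)))
        = \<alpha> x y \<otimes>\<^bsub>k\<^esub> basis_element k L (x \<otimes>\<^bsub>L\<^esub> y) z" (is "finsum k ?f _ = ?r")
    if z: "z \<in> carrier L" for z
  proof -
    have eq: "inv\<^bsub>L\<^esub> x \<otimes>\<^bsub>L\<^esub> z = y \<longleftrightarrow> z = x \<otimes>\<^bsub>L\<^esub> y"
      using x y z L.inv_solve_left[of y x z] by auto
    have "finsum k ?f (carrier L) =
        (\<Oplus>\<^bsub>k\<^esub>u \<in> carrier L. if x = u
           then \<alpha> x y \<otimes>\<^bsub>k\<^esub> basis_element k L (x \<otimes>\<^bsub>L\<^esub> y) z else \<zero>\<^bsub>k\<^esub>)"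
      using x y z eq \<alpha>_closed
      by (intro k.add.finprod_cong') (auto simp: basis_element_def)
    also have "\<dots> = ?r"
      using k.add.finprod_singleton[OF x assms(3), of "\<lambda>_. ?r"] x y z \<alpha>_closed
      by (simp add: basis_element_def)
    finally show ?thesis .
  qed
  then show ?thesis
    unfolding A_def twisted_group_algebra_def by (auto intro!: restrict_ext)
qed

text \<open>Linear maps are taken to be extensional, so that equality of maps is equality on the
  carrier. The ring-multiplication fields of the records for vector spaces are unused.\<close>

definition derivations ::
    "('k, 'n) ring_scheme \<Rightarrow> ('k, 'a, 'm) module_scheme \<Rightarrow> ('a \<Rightarrow> 'a) set" where
  "derivations k A =
     {D \<in> carrier A \<rightarrow>\<^sub>E carrier A.
        (\<forall>x \<in> carrier A. \<forall>y \<in> carrier A. D (x \<oplus>\<^bsub>A\<^esub> y) = D x \<oplus>\<^bsub>A\<^esub> D y) \<and>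
        (\<forall>c \<in> carrier k. \<forall>x \<in> carrier A. D (c \<odot>\<^bsub>A\<^esub> x) = c \<odot>\<^bsub>A\<^esub> D x) \<and>
        (\<forall>x \<in> carrier A. \<forall>y \<in> carrier A.
           D (x \<otimes>\<^bsub>A\<^esub> y) = (D x \<otimes>\<^bsub>A\<^esub> y) \<oplus>\<^bsub>A\<^esub> (x \<otimes>\<^bsub>A\<^esub> D y))}"

definition inner_derivations :: "('k, 'a, 'm) module_scheme \<Rightarrow> ('a \<Rightarrow> 'a) set" where
  "inner_derivations A =
     (\<lambda>a. \<lambda>x \<in> carrier A. (a \<otimes>\<^bsub>A\<^esub> x) \<ominus>\<^bsub>A\<^esub> (x \<otimes>\<^bsub>A\<^esub> a)) ` carrier A"

definition derivation_space ::
    "('k, 'n) ring_scheme \<Rightarrow> ('k, 'a, 'm) module_scheme \<Rightarrow> ('k, 'a \<Rightarrow> 'a) module" where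
  "derivation_space k A =
     \<lparr>carrier = derivations k A,
      monoid.mult = undefined,
      monoid.one = undefined,
      ring.zero = (\<lambda>x \<in> carrier A. \<zero>\<^bsub>A\<^esub>),
      ring.add = (\<lambda>D E. \<lambda>x \<in> carrier A. D x \<oplus>\<^bsub>A\<^esub> E x),
      smult = (\<lambda>c D. \<lambda>x \<in> carrier A. c \<odot>\<^bsub>A\<^esub> D x)\<rparr>"

definition quotient_module ::
    "('k, 'a, 'm) module_scheme \<Rightarrow> 'a set \<Rightarrow> ('k, 'a set) module" where
  "quotient_module M N =
     \<lparr>carrier = a_rcosets\<^bsub>M\<^esub> N,
      monoid.mult = undefined,
      monoid.one = undefined,
      ring.zero = N,
      ring.add = set_add M,
      smult = (\<lambda>c S. \<Union>x\<in>S. N +>\<^bsub>M\<^esub> (c \<odot>\<^bsub>M\<^esub> x))\<rparr>"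

definition HH1 ::
    "('k, 'n) ring_scheme \<Rightarrow> ('k, 'a, 'm) module_scheme \<Rightarrow> ('k, ('a \<Rightarrow> 'a) set) module" where
  "HH1 k A = quotient_module (derivation_space k A) (inner_derivations A)"

end

theory Submission
  imports Defs
begin

text \<open>
  Let \<open>A = k\<^sub>\<alpha>L\<close>, write \<open>[g]\<close> for the basis element of \<open>g\<close>, and let \<open>L\<close> act on \<open>A\<close> by conjugation with
  the units \<open>[g]\<close>. A linear map \<open>D\<close> on \<open>A\<close> can be written as \<open>D [g] = d(g) [g]\<close>, and then \<open>D\<close> is a
  derivation iff \<open>d\<close> is a 1-cocycle, \<open>d(gh) = d(g) + g\<cdot>d(h)\<close>, and is inner iff \<open>d\<close> is a
  coboundary. So it is enough to find a cocycle \<open>L \<rightarrow> A\<close> that is not a coboundary.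

  Fix an \<open>\<alpha>\<close>-regular \<open>x\<close> with centralizer \<open>C\<close> such that \<open>p\<close> divides \<open>|C : C'|\<close>. Regularity says
  that \<open>C\<close> fixes \<open>[x]\<close>, not merely the line through it. Hence for \<open>y = t x t\<^sup>-\<^sup>1\<close> the element
  \<open>e\<^sub>y = t\<cdot>[x]\<close> depends only on \<open>y\<close>, and \<open>L\<close> permutes the \<open>e\<^sub>y\<close>: the span of the conjugacy class
  of \<open>x\<close> is a submodule of \<open>A\<close> isomorphic to the permutation module \<open>k[L/C]\<close>
  (\<open>lift_coeff_eq\<close>, \<open>lift_coeff_conj\<close>). By Shapiro's lemma its first cohomology is \<open>Hom(C, k)\<close>.
  Explicitly, with \<open>t\<^sub>y\<close> a chosen element conjugating \<open>x\<close> to \<open>y\<close>, a homomorphism \<open>f: C \<rightarrow> k\<close> gives the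
  cocycle \<open>d(g) = \<Sum>\<^sub>y f(t\<^sub>y\<^sup>-\<^sup>1 g t\<^sub>w) e\<^sub>y\<close>, where \<open>w = g\<^sup>-\<^sup>1yg\<close>.

  If the resulting derivation were the commutator with some \<open>a\<close>, then for \<open>c \<in> C\<close> the coefficient of
  \<open>xc\<close> in \<open>D [c]\<close> would be \<open>a(x)(\<alpha>(x,c) - \<alpha>(c,x)) = 0\<close>; but it is a unit times \<open>f(c)\<close>. So every
  nonzero \<open>f\<close> gives a nonzero class (\<open>class_derivation_inner_imp_zero\<close>). A nonzero \<open>f\<close> exists because
  the finite abelian group \<open>C/C'\<close>, having order divisible by \<open>p\<close>, maps onto the group of order \<open>p\<close>
  generated by 1 in \<open>k\<close> (\<open>hom_of_dvd_abelianization_index\<close>).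
\<close>

section \<open>Homomorphisms onto a group of order \<open>p\<close>\<close>

text \<open>By Cauchy's theorem the \<open>p\<close>-th power map is not injective, hence by finiteness not surjective. Let
  \<open>M\<close> be maximal among the proper subgroups containing all \<open>p\<close>-th powers, and let \<open>g\<close> lie outside
  \<open>M\<close>. Maximality gives \<open>G = M\<langle>g\<rangle>\<close>, and \<open>g\<^sup>n \<in> M\<close> iff \<open>p\<close> divides \<open>n\<close>; as \<open>u\<^sup>p = 1\<close>, \<open>m g\<^sup>n \<mapsto> u\<^sup>n\<close> is a
  well-defined homomorphism.\<close>

lemma (in comm_group) hom_onto_element_of_order_p:
  fixes p :: nat
  assumes fin: "finite (carrier G)" and p: "Factorial_Ring.prime p" and dvd: "p dvd order G"
    and H: "group H" and u: "u \<in> carrier H" "u [^]\<^bsub>H\<^esub> p = \<one>\<^bsub>H\<^esub>"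
  shows "\<exists>f \<in> hom G H. u \<in> f ` carrier G"
proof -
  interpret H: group H by fact
  define P where "P = (\<lambda>q. q [^] p) ` carrier G"
  have pow_hom: "(\<lambda>q. q [^] p) \<in> hom G G"
    by (auto simp: hom_def nat_pow_distrib)
  interpret pow: group_hom G G "\<lambda>q. q [^] p"
    by unfold_locales (rule pow_hom)
  have P: "subgroup P G"
    unfolding P_def by (rule pow.img_is_subgroup)
  have "P \<noteq> carrier G"
  proof
    assume "P = carrier G"
    then have inj: "inj_on (\<lambda>q. q [^] p) (carrier G)"
      unfolding P_def using fin by (simp add: eq_card_imp_inj_on)
    \<comment> \<open>A Sylow argument for the exponent 1 supplies an element of order \<open>p\<close>.\<close>
    obtain m where "order G = p ^ 1 * m" using dvd by auto
    then obtain S where S: "subgroup S G" "card S = p"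
      using sylow_thm[of p G 1 m] p fin is_group by auto
    have "finite S" using S(2) p prime_gt_0_nat by (metis card.infinite less_irrefl)
    then have "\<exists>s\<in>S. s \<noteq> \<one>"
      using S(2) p prime_gt_1_nat[of p] card_mono[of "{\<one>}" S] by fastforce
    then obtain s where s: "s \<in> S" "s \<noteq> \<one>" by blast
    interpret S: group "G\<lparr>carrier := S\<rparr>" using S(1) by (rule subgroup_imp_group)
    have "s [^] p = \<one>"
      using S.pow_order_eq_1[of s] s S(2) \<open>finite S\<close>
      by (simp add: order_def flip: nat_pow_consistent)
    moreover have "s \<in> carrier G" using s S(1) subgroup.mem_carrier by fast
    ultimately show False
      using inj_onD[OF inj, of s "\<one>"] s(2) by simp
  qed
  define proper where "proper = {M. subgroup M G \<and> P \<subseteq> M \<and> M \<noteq> carrier G}"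
  have "proper \<subseteq> Pow (carrier G)" by (auto simp: proper_def dest: subgroup.subset)
  then have "finite proper" using fin finite_subset by blast
  moreover have "P \<in> proper" using P \<open>P \<noteq> carrier G\<close> by (simp add: proper_def)
  ultimately obtain M where M: "M \<in> proper" and max: "\<And>N. N \<in> proper \<Longrightarrow> M \<subseteq> N \<Longrightarrow> M = N"
    using finite_has_maximal[of proper] by blast
  interpret M: subgroup M G using M by (simp add: proper_def)
  obtain g where g: "g \<in> carrier G" "g \<notin> M"
    using M M.subset by (auto simp: proper_def)
  have dvd_in_M: "g [^] n \<in> M" if "p dvd n" for n :: nat
  proof -
    obtain j where "n = j * p" using \<open>p dvd n\<close> by (metis dvdE mult.commute)
    then have "g [^] n = (g [^] j) [^] p" using g by (simp add: nat_pow_pow)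
    moreover have "(g [^] j) [^] p \<in> P"
      unfolding P_def using g by (intro imageI) simp
    ultimately show ?thesis using M by (auto simp: proper_def)
  qed
  have M_dvd: "p dvd n" if n: "g [^] n \<in> M" for n :: nat
  proof (rule ccontr)
    assume "\<not> p dvd n"
    then have n0: "n \<noteq> 0" and "coprime n p"
      using p prime_imp_coprime coprime_commute by (metis dvd_0_right)+
    \<comment> \<open>The Bezout identity would express \<open>g\<close> through \<open>g\<^sup>n\<close> and \<open>g\<^sup>p\<close>, both in \<open>M\<close>.\<close>
    then obtain i j where ij: "n * i = p * j + 1"
      using bezout_nat[OF n0, of p] by auto
    have "g [^] (p * j) \<otimes> g = (g [^] n) [^] i"
      using g ij by (simp add: nat_pow_pow)
    also have "\<dots> \<in> M"
      using n by (induction i) auto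
    finally have 1: "g [^] (p * j) \<otimes> g \<in> M" .
    have "g = inv (g [^] (p * j)) \<otimes> (g [^] (p * j) \<otimes> g)"
      using g by (simp add: inv_solve_left)
    also have "\<dots> \<in> M"
      using 1 dvd_in_M[of "p * j"] by auto
    finally show False using g by blast
  qed
  define R where "R q n \<longleftrightarrow> (\<exists>m\<in>M. q = m \<otimes> g [^] n)" for q and n :: nat
  have R_ex: "\<exists>n. R q n" if q: "q \<in> carrier G" for q
  proof -
    define N where "N = M <#> generate G {g}"
    have gen: "subgroup (generate G {g}) G" using g by (intro generate_is_subgroup) auto
    have N: "subgroup N G"
      unfolding N_def by (intro mult_subgroups M.subgroup_axioms gen)
    have MN: "M \<subseteq> N"
    proof
      fix m assume "m \<in> M"
      then have "m \<otimes> \<one> \<in> N" unfolding N_def set_mult_def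
        using subgroup.one_closed[OF gen] by blast
      then show "m \<in> N" using \<open>m \<in> M\<close> by simp
    qed
    have "\<one> \<otimes> g \<in> N" unfolding N_def set_mult_def
      using generate.incl[of g "{g}"] M.one_closed by blast
    then have "g \<in> N" using g by simp
    then have "N \<noteq> M" using g by blast
    then have "N = carrier G" using max[of N] N MN M by (auto simp: proper_def)
    then obtain m h where mh: "m \<in> M" "h \<in> generate G {g}" "q = m \<otimes> h"
      using q unfolding N_def set_mult_def by blast
    have "\<exists>n::nat. h = g [^] n"
      using generate_pow_nat[of g] mh(2) g fin ord_ge_1[OF fin g(1)] by auto
    then show ?thesis using mh by (auto simp: R_def)
  qed
  have R_le: "u [^]\<^bsub>H\<^esub> n = u [^]\<^bsub>H\<^esub> n'" if "R q n" "R q n'" "n \<le> n'" for q n n'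
  proof -
    obtain m where m: "m \<in> M" "q = m \<otimes> g [^] n"
      using \<open>R q n\<close> unfolding R_def ..
    obtain m' where m': "m' \<in> M" "q = m' \<otimes> g [^] n'"
      using \<open>R q n'\<close> unfolding R_def ..
    obtain d where d: "n' = d + n" using \<open>n \<le> n'\<close> by (metis add.commute le_Suc_ex)
    have "m' \<otimes> g [^] d \<otimes> g [^] n = m \<otimes> g [^] n"
      using m(2) m' g d by (simp add: m_assoc nat_pow_mult)
    then have "m' \<otimes> g [^] d = m" using m(1) m'(1) g by simp
    then have "g [^] d = inv m' \<otimes> m"
      using inv_solve_left[of "g [^] d" m' m] m(1) m'(1) g by simp
    then have "p dvd d" using m(1) m'(1) M_dvd[of d] by simp
    then obtain j where "d = p * j" by (rule dvdE)
    then have "u [^]\<^bsub>H\<^esub> d = \<one>\<^bsub>H\<^esub>" using u by (simp flip: H.nat_pow_pow)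
    then show ?thesis using d u by (simp flip: H.nat_pow_mult)
  qed
  define f where "f q = u [^]\<^bsub>H\<^esub> (SOME n. R q n)" for q
  have f: "f q = u [^]\<^bsub>H\<^esub> n" if "R q n" for q n
    unfolding f_def using someI[of "R q", OF that] that R_le nat_le_linear by metis
  have "f \<in> hom G H"
  proof (rule homI)
    fix a b assume a: "a \<in> carrier G" and b: "b \<in> carrier G"
    obtain n where n: "R a n" using R_ex a by blast
    obtain n' where n': "R b n'" using R_ex b by blast
    obtain m where m: "m \<in> M" "a = m \<otimes> g [^] n"
      using n unfolding R_def ..
    obtain m' where m': "m' \<in> M" "b = m' \<otimes> g [^] n'"
      using n' unfolding R_def ..
    have "a \<otimes> b = (m \<otimes> m') \<otimes> g [^] (n + n')"
      using m m' g by (simp add: m_ac flip: nat_pow_mult)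
    then have "R (a \<otimes> b) (n + n')" unfolding R_def using m(1) m'(1) by blast
    then show "f (a \<otimes> b) = f a \<otimes>\<^bsub>H\<^esub> f b"
      using f n n' u by (simp add: H.nat_pow_mult)
    show "f a \<in> carrier H" using u by (simp add: f_def)
  qed
  moreover have "R g 1" unfolding R_def using g by (auto intro!: bexI[of _ \<one>])
  then have "f g = u" using f[of g 1] u by simp
  ultimately show ?thesis using g by blast
qed

lemma (in group) hom_of_dvd_abelianization_index:
  fixes p :: nat
  assumes C: "subgroup C G" and fin: "finite C" and p: "Factorial_Ring.prime p"
    and dvd: "p dvd abelianization_index G C"
    and H: "group H" and u: "u \<in> carrier H" "u [^]\<^bsub>H\<^esub> p = \<one>\<^bsub>H\<^esub>"
  shows "\<exists>f \<in> hom (G\<lparr>carrier := C\<rparr>) H. u \<in> f ` C"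
proof -
  let ?C = "G\<lparr>carrier := C\<rparr>" and ?Q = "G\<lparr>carrier := C\<rparr> Mod derived G C"
  interpret Q: comm_group ?Q using C by (rule derived_quot_of_subgroup_is_comm_group)
  have D: "derived G C \<lhd> ?C" using C by (rule derived_subgroup_is_normal)
  have carrier: "carrier ?Q = (\<lambda>c. derived G C #>\<^bsub>?C\<^esub> c) ` C"
    by (auto simp: FactGroup_def RCOSETS_def)
  have "finite (carrier ?Q)" unfolding carrier using fin by simp
  moreover have "p dvd order ?Q"
    using dvd by (simp add: abelianization_index_def order_def FactGroup_def)
  ultimately obtain f where f: "f \<in> hom ?Q H" "u \<in> f ` carrier ?Q"
    using Q.hom_onto_element_of_order_p[OF _ p _ H u] by blast
  have "(\<lambda>c. derived G C #>\<^bsub>?C\<^esub> c) \<in> hom ?C ?Q"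
    using normal.r_coset_hom_Mod[OF D] .
  then have "f \<circ> (\<lambda>c. derived G C #>\<^bsub>?C\<^esub> c) \<in> hom ?C H"
    using f(1) by (rule Group.hom_compose)
  moreover have "u \<in> (f \<circ> (\<lambda>c. derived G C #>\<^bsub>?C\<^esub> c)) ` C"
    using f(2) unfolding carrier by auto
  ultimately show ?thesis by blast
qed

section \<open>Hochschild classes and inner derivations\<close>

text \<open>If all cosets of the inner derivations agree, so does the one of \<open>D\<close>; it contains \<open>D = 0 + D\<close>
  as soon as the zero map is inner.\<close>

lemma trivial_HH1_imp_inner:
  assumes A: "abelian_group A"
    and zero: "(\<lambda>x \<in> carrier A. \<zero>\<^bsub>A\<^esub>) \<in> inner_derivations A"
    and triv: "carrier (HH1 k A) = {\<zero>\<^bsub>HH1 k A\<^esub>}"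
    and D: "D \<in> derivations k A"
  shows "D \<in> inner_derivations A"
proof -
  interpret abelian_group A by fact
  let ?S = "derivation_space k A"
  have "inner_derivations A +>\<^bsub>?S\<^esub> D \<in> carrier (HH1 k A)"
    using D by (auto simp: HH1_def quotient_module_def A_RCOSETS_def' derivation_space_def)
  then have "inner_derivations A +>\<^bsub>?S\<^esub> D = inner_derivations A"
    using triv by (simp add: HH1_def quotient_module_def)
  moreover have "D = (\<lambda>x \<in> carrier A. \<zero>\<^bsub>A\<^esub>) \<oplus>\<^bsub>?S\<^esub> D"
    using D by (auto simp: derivation_space_def derivations_def PiE_def Pi_iff extensional_def fun_eq_iff)
  then have "D \<in> inner_derivations A +>\<^bsub>?S\<^esub> D"
    using zero unfolding a_r_coset_def' by blast
  ultimately show ?thesis by simp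
qed

section \<open>Coefficients in the twisted group algebra\<close>

lemma (in comm_monoid) finprod_swap:
  assumes "finite A" and "finite B"
    and "\<And>a b. a \<in> A \<Longrightarrow> b \<in> B \<Longrightarrow> f a b \<in> carrier G"
  shows "(\<Otimes>a\<in>A. \<Otimes>b\<in>B. f a b) = (\<Otimes>b\<in>B. \<Otimes>a\<in>A. f a b)"
  using assms(1,3)
proof (induction A rule: finite_induct)
  case (insert x A)
  have "(\<Otimes>a\<in>insert x A. \<Otimes>b\<in>B. f a b) = (\<Otimes>b\<in>B. f x b) \<otimes> (\<Otimes>b\<in>B. \<Otimes>a\<in>A. f a b)"
    using insert by (subst finprod_insert) (auto simp: Pi_def intro!: finprod_closed)
  also have "\<dots> = (\<Otimes>b\<in>B. f x b \<otimes> (\<Otimes>a\<in>A. f a b))"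
    using insert by (subst finprod_multf) (auto simp: Pi_def intro!: finprod_closed)
  also have "\<dots> = (\<Otimes>b\<in>B. \<Otimes>a\<in>insert x A. f a b)"
    using insert by (intro finprod_cong') (auto simp: Pi_def intro!: finprod_closed)
  finally show ?case .
qed simp

locale twisted_group = k: field k + L: group L
  for k :: "('k, 'm) ring_scheme" (structure) and L :: "('g, 'n) monoid_scheme" (structure) +
  fixes \<alpha> :: "'g \<Rightarrow> 'g \<Rightarrow> 'k"
  assumes finite_L: "finite (carrier L)"
    and cocycle: "\<alpha> \<in> two_cocycles L (units_of k)"
begin

abbreviation A :: "('k, 'g \<Rightarrow> 'k) module" where
  "A \<equiv> twisted_group_algebra k L \<alpha>"

lemma \<alpha>_unit: "x \<in> carrier L \<Longrightarrow> y \<in> carrier L \<Longrightarrow> \<alpha> x y \<in> Units k"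
  using cocycle unfolding two_cocycles_def units_of_def by fastforce

lemma \<alpha>_closed [simp]: "x \<in> carrier L \<Longrightarrow> y \<in> carrier L \<Longrightarrow> \<alpha> x y \<in> carrier k"
  using \<alpha>_unit by (rule k.Units_closed)

lemma \<alpha>_cocycle:
  "x \<in> carrier L \<Longrightarrow> y \<in> carrier L \<Longrightarrow> z \<in> carrier L \<Longrightarrow>
    \<alpha> (x \<otimes>\<^bsub>L\<^esub> y) z \<otimes> \<alpha> x y = \<alpha> x (y \<otimes>\<^bsub>L\<^esub> z) \<otimes> \<alpha> y z"
  using cocycle by (simp add: two_cocycles_def units_of_def)

lemma \<alpha>_cancel:
  assumes "x \<in> carrier L" "y \<in> carrier L" "a \<in> carrier k" "b \<in> carrier k"
    and "a \<otimes> \<alpha> x y = b \<otimes> \<alpha> x y"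
  shows "a = b"
  using assms \<alpha>_unit[of x y] k.Units_l_cancel[of "\<alpha> x y" a b] by (simp add: k.m_comm)

lemma inv_mult_cancel [simp]:
  "x \<in> carrier L \<Longrightarrow> y \<in> carrier L \<Longrightarrow> inv\<^bsub>L\<^esub> x \<otimes>\<^bsub>L\<^esub> (x \<otimes>\<^bsub>L\<^esub> y) = y"
  by (simp flip: L.m_assoc)

lemma carrier_A: "carrier A = carrier L \<rightarrow>\<^sub>E carrier k"
  by (simp add: twisted_group_algebra_def)

lemma A_closed [simp]: "a \<in> carrier A \<Longrightarrow> x \<in> carrier L \<Longrightarrow> a x \<in> carrier k"
  by (auto simp: carrier_A)

lemma A_eqI:
  assumes "a \<in> carrier A" "b \<in> carrier A" "\<And>x. x \<in> carrier L \<Longrightarrow> a x = b x"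
  shows "a = b"
  using assms unfolding carrier_A by (rule PiE_ext)

lemma add_A [simp]: "x \<in> carrier L \<Longrightarrow> (a \<oplus>\<^bsub>A\<^esub> b) x = a x \<oplus> b x"
  by (simp add: twisted_group_algebra_def)

lemma zero_A [simp]: "x \<in> carrier L \<Longrightarrow> \<zero>\<^bsub>A\<^esub> x = \<zero>"
  by (simp add: twisted_group_algebra_def)

lemma smult_A [simp]: "x \<in> carrier L \<Longrightarrow> (c \<odot>\<^bsub>A\<^esub> a) x = c \<otimes> a x"
  by (simp add: twisted_group_algebra_def)

lemma mult_A:
  "z \<in> carrier L \<Longrightarrow> (a \<otimes>\<^bsub>A\<^esub> b) z =
    (\<Oplus>x\<in>carrier L. \<alpha> x (inv\<^bsub>L\<^esub> x \<otimes>\<^bsub>L\<^esub> z) \<otimes> (a x \<otimes> b (inv\<^bsub>L\<^esub> x \<otimes>\<^bsub>L\<^esub> z)))"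
  by (simp add: twisted_group_algebra_def)

lemma add_A_closed: "a \<in> carrier A \<Longrightarrow> b \<in> carrier A \<Longrightarrow> a \<oplus>\<^bsub>A\<^esub> b \<in> carrier A"
  by (auto simp: twisted_group_algebra_def)

lemma zero_A_closed: "\<zero>\<^bsub>A\<^esub> \<in> carrier A"
  by (auto simp: twisted_group_algebra_def)

lemma smult_A_closed: "c \<in> carrier k \<Longrightarrow> a \<in> carrier A \<Longrightarrow> c \<odot>\<^bsub>A\<^esub> a \<in> carrier A"
  by (auto simp: twisted_group_algebra_def)

lemma mult_A_closed: "a \<in> carrier A \<Longrightarrow> b \<in> carrier A \<Longrightarrow> a \<otimes>\<^bsub>A\<^esub> b \<in> carrier A"
  by (auto simp: twisted_group_algebra_def intro!: k.finsum_closed k.m_closed PiE_mem)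

lemma abelian_group_A: "abelian_group A"
proof (rule abelian_groupI)
  fix a assume a: "a \<in> carrier A"
  let ?n = "\<lambda>x \<in> carrier L. \<ominus> a x"
  have "?n \<in> carrier A" using a by (auto simp: carrier_A)
  moreover have "?n \<oplus>\<^bsub>A\<^esub> a = \<zero>\<^bsub>A\<^esub>"
    using a calculation
    by (intro A_eqI) (auto simp: k.l_neg intro!: add_A_closed zero_A_closed)
  ultimately show "\<exists>y\<in>carrier A. y \<oplus>\<^bsub>A\<^esub> a = \<zero>\<^bsub>A\<^esub>" by blast
qed (auto intro!: A_eqI add_A_closed zero_A_closed simp: k.a_ac)

lemma minus_A:
  assumes a: "a \<in> carrier A" and b: "b \<in> carrier A" and x: "x \<in> carrier L"
  shows "(a \<ominus>\<^bsub>A\<^esub> b) x = a x \<ominus> b x"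
proof -
  interpret A: abelian_group A by (rule abelian_group_A)
  let ?c = "a \<ominus>\<^bsub>A\<^esub> b"
  have "?c \<in> carrier A" using a b by simp
  have "?c \<oplus>\<^bsub>A\<^esub> b = a"
    using a b by (simp add: A.minus_eq A.a_assoc A.l_neg)
  then have "?c x \<oplus> b x = a x"
    using x by (metis add_A)
  then show ?thesis
    using \<open>?c \<in> carrier A\<close> a b x by (simp add: k.minus_eq k.add.inv_solve_right)
qed

lemma basis_closed: "x \<in> carrier L \<Longrightarrow> basis_element k L x \<in> carrier A"
  by (auto simp: basis_element_def carrier_A)

lemma mult_basis_right:
  assumes a: "a \<in> carrier A" and x: "x \<in> carrier L" and g: "g \<in> carrier L"
  shows "(a \<otimes>\<^bsub>A\<^esub> basis_element k L g) (x \<otimes>\<^bsub>L\<^esub> g) = \<alpha> x g \<otimes> a x"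
proof -
  have eq: "inv\<^bsub>L\<^esub> u \<otimes>\<^bsub>L\<^esub> (x \<otimes>\<^bsub>L\<^esub> g) = g \<longleftrightarrow> x = u" if "u \<in> carrier L" for u
    using x g that by (auto simp: L.inv_solve_left' )
  have "(a \<otimes>\<^bsub>A\<^esub> basis_element k L g) (x \<otimes>\<^bsub>L\<^esub> g) =
      (\<Oplus>u\<in>carrier L. if x = u then \<alpha> x g \<otimes> a x else \<zero>)"
    unfolding mult_A[OF L.m_closed[OF x g]]
    using a x g eq by (intro k.add.finprod_cong') (auto simp: basis_element_def)
  also have "\<dots> = \<alpha> x g \<otimes> a x"
    using k.add.finprod_singleton[OF x finite_L, of "\<lambda>_. \<alpha> x g \<otimes> a x"] a x g by simp
  finally show ?thesis .
qed

lemma mult_basis_left: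
  assumes a: "a \<in> carrier A" and x: "x \<in> carrier L" and g: "g \<in> carrier L"
  shows "(basis_element k L g \<otimes>\<^bsub>A\<^esub> a) (g \<otimes>\<^bsub>L\<^esub> x) = \<alpha> g x \<otimes> a x"
proof -
  have "(basis_element k L g \<otimes>\<^bsub>A\<^esub> a) (g \<otimes>\<^bsub>L\<^esub> x) =
      (\<Oplus>u\<in>carrier L. if g = u then \<alpha> g x \<otimes> a x else \<zero>)"
    unfolding mult_A[OF L.m_closed[OF g x]]
    using a x g
    by (intro k.add.finprod_cong') (auto simp: basis_element_def L.inv_solve_left')
  also have "\<dots> = \<alpha> g x \<otimes> a x"
    using k.add.finprod_singleton[OF g finite_L, of "\<lambda>_. \<alpha> g x \<otimes> a x"] a x g by simp
  finally show ?thesis .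
qed

lemma zero_inner: "(\<lambda>x \<in> carrier A. \<zero>\<^bsub>A\<^esub>) \<in> inner_derivations A"
proof -
  interpret A: abelian_group A by (rule abelian_group_A)
  have zl: "\<zero>\<^bsub>A\<^esub> \<otimes>\<^bsub>A\<^esub> a = \<zero>\<^bsub>A\<^esub>" if a: "a \<in> carrier A" for a
    using a by (intro A_eqI mult_A_closed zero_A_closed) (auto simp: mult_A intro!: k.add.finprod_one_eqI)
  have zr: "a \<otimes>\<^bsub>A\<^esub> \<zero>\<^bsub>A\<^esub> = \<zero>\<^bsub>A\<^esub>" if a: "a \<in> carrier A" for a
    using a by (intro A_eqI mult_A_closed zero_A_closed) (auto simp: mult_A intro!: k.add.finprod_one_eqI)
  have "(\<lambda>x \<in> carrier A. \<zero>\<^bsub>A\<^esub>) =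
      (\<lambda>x \<in> carrier A. (\<zero>\<^bsub>A\<^esub> \<otimes>\<^bsub>A\<^esub> x) \<ominus>\<^bsub>A\<^esub> (x \<otimes>\<^bsub>A\<^esub> \<zero>\<^bsub>A\<^esub>))"
    by (intro restrict_ext) (simp add: zl zr A.minus_eq A.r_neg)
  then show ?thesis unfolding inner_derivations_def using zero_A_closed by blast
qed

lemma sum_left_translate:
  assumes "u \<in> carrier L" and "\<And>g. g \<in> carrier L \<Longrightarrow> F g \<in> carrier k"
  shows "(\<Oplus>g\<in>carrier L. F g) = (\<Oplus>h\<in>carrier L. F (u \<otimes>\<^bsub>L\<^esub> h))"
proof -
  have "(\<lambda>h. u \<otimes>\<^bsub>L\<^esub> h) ` carrier L = carrier L"
    using assms(1) by (rule L.surj_const_mult)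
  then show ?thesis
    using k.add.finprod_reindex[of F "\<lambda>h. u \<otimes>\<^bsub>L\<^esub> h" "carrier L"] assms L.inj_on_cmult
    by (auto simp: Pi_def)
qed

lemma sum_inverse_translate:
  assumes z: "z \<in> carrier L" and F: "\<And>g. g \<in> carrier L \<Longrightarrow> F g \<in> carrier k"
  shows "(\<Oplus>g\<in>carrier L. F g) = (\<Oplus>h\<in>carrier L. F (z \<otimes>\<^bsub>L\<^esub> inv\<^bsub>L\<^esub> h))"
proof -
  let ?h = "\<lambda>h. z \<otimes>\<^bsub>L\<^esub> inv\<^bsub>L\<^esub> h"
  have inj: "inj_on ?h (carrier L)"
    using z by (auto simp: inj_on_def L.inv_inj)
  have "?h ` carrier L = carrier L"
    using inj z finite_L by (intro endo_inj_surj) auto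
  then show ?thesis
    using k.add.finprod_reindex[of F ?h "carrier L"] F inj by (auto simp: Pi_def)
qed

text \<open>A matrix \<open>V\<close> defines a linear map by \<open>[g] \<mapsto> \<Sum>\<^sub>z V(z, g) [z]\<close>. The hypothesis \<open>leibniz\<close> compares the
  coefficients of \<open>[z]\<close> on the two sides of the product rule for \<open>[g] [h]\<close>; bilinearity does the rest.\<close>

lemma linear_extension_derivation:
  assumes V [simp]: "\<And>z g. z \<in> carrier L \<Longrightarrow> g \<in> carrier L \<Longrightarrow> V z g \<in> carrier k"
    and leibniz: "\<And>z g h. z \<in> carrier L \<Longrightarrow> g \<in> carrier L \<Longrightarrow> h \<in> carrier L \<Longrightarrow>
      V z (g \<otimes>\<^bsub>L\<^esub> h) \<otimes> \<alpha> g h =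
        \<alpha> (z \<otimes>\<^bsub>L\<^esub> inv\<^bsub>L\<^esub> h) h \<otimes> V (z \<otimes>\<^bsub>L\<^esub> inv\<^bsub>L\<^esub> h) g \<oplus>
        \<alpha> g (inv\<^bsub>L\<^esub> g \<otimes>\<^bsub>L\<^esub> z) \<otimes> V (inv\<^bsub>L\<^esub> g \<otimes>\<^bsub>L\<^esub> z) h"
  defines "D \<equiv> \<lambda>a \<in> carrier A. \<lambda>z \<in> carrier L. \<Oplus>g\<in>carrier L. V z g \<otimes> a g"
  shows "D \<in> derivations k A"
proof -
  have D: "D a z = (\<Oplus>g\<in>carrier L. V z g \<otimes> a g)" if "a \<in> carrier A" "z \<in> carrier L" for a z
    using that by (simp add: D_def)
  have D_closed: "D a \<in> carrier A" if "a \<in> carrier A" for a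
    using that by (auto simp: D_def carrier_A intro!: k.finsum_closed)
  have D_add: "D (a \<oplus>\<^bsub>A\<^esub> b) = D a \<oplus>\<^bsub>A\<^esub> D b" if a: "a \<in> carrier A" and b: "b \<in> carrier A" for a b
  proof (intro A_eqI D_closed add_A_closed a b)
    fix z assume z: "z \<in> carrier L"
    have "D (a \<oplus>\<^bsub>A\<^esub> b) z = (\<Oplus>g\<in>carrier L. V z g \<otimes> a g \<oplus> V z g \<otimes> b g)"
      unfolding D[OF add_A_closed[OF a b] z]
      using a b z by (intro k.finsum_cong') (auto simp: k.r_distr)
    also have "\<dots> = (D a \<oplus>\<^bsub>A\<^esub> D b) z"
      using a b z by (simp add: D k.finsum_addf Pi_def)
    finally show "D (a \<oplus>\<^bsub>A\<^esub> b) z = (D a \<oplus>\<^bsub>A\<^esub> D b) z" .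
  qed
  have D_smult: "D (c \<odot>\<^bsub>A\<^esub> a) = c \<odot>\<^bsub>A\<^esub> D a" if c: "c \<in> carrier k" and a: "a \<in> carrier A" for c a
  proof (intro A_eqI D_closed smult_A_closed a c)
    fix z assume z: "z \<in> carrier L"
    have "D (c \<odot>\<^bsub>A\<^esub> a) z = (\<Oplus>g\<in>carrier L. c \<otimes> (V z g \<otimes> a g))"
      unfolding D[OF smult_A_closed[OF c a] z]
      using a c z by (intro k.finsum_cong') (auto simp: k.m_lcomm)
    also have "\<dots> = (c \<odot>\<^bsub>A\<^esub> D a) z"
      using a c z finite_L by (simp add: D k.finsum_rdistr Pi_def)
    finally show "D (c \<odot>\<^bsub>A\<^esub> a) z = (c \<odot>\<^bsub>A\<^esub> D a) z" .
  qed
  have D_mult: "D (a \<otimes>\<^bsub>A\<^esub> b) = (D a \<otimes>\<^bsub>A\<^esub> b) \<oplus>\<^bsub>A\<^esub> (a \<otimes>\<^bsub>A\<^esub> D b)"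
    if a: "a \<in> carrier A" and b: "b \<in> carrier A" for a b
  proof (intro A_eqI D_closed add_A_closed mult_A_closed a b)
    fix z assume z: "z \<in> carrier L"
    \<comment> \<open>\<open>?P\<close> and \<open>?Q\<close> are the summands of \<open>(D a) b\<close> and of \<open>a (D b)\<close> that come from \<open>a(g) [g]\<close> and \<open>b(h) [h]\<close>.\<close>
    let ?P = "\<lambda>g h. \<alpha> (z \<otimes>\<^bsub>L\<^esub> inv\<^bsub>L\<^esub> h) h \<otimes> V (z \<otimes>\<^bsub>L\<^esub> inv\<^bsub>L\<^esub> h) g \<otimes> (a g \<otimes> b h)"
    let ?Q = "\<lambda>g h. \<alpha> g (inv\<^bsub>L\<^esub> g \<otimes>\<^bsub>L\<^esub> z) \<otimes> V (inv\<^bsub>L\<^esub> g \<otimes>\<^bsub>L\<^esub> z) h \<otimes> (a g \<otimes> b h)"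
    have "D (a \<otimes>\<^bsub>A\<^esub> b) z = (\<Oplus>w\<in>carrier L. \<Oplus>g\<in>carrier L.
        V z w \<otimes> (\<alpha> g (inv\<^bsub>L\<^esub> g \<otimes>\<^bsub>L\<^esub> w) \<otimes> (a g \<otimes> b (inv\<^bsub>L\<^esub> g \<otimes>\<^bsub>L\<^esub> w))))"
      unfolding D[OF mult_A_closed[OF a b] z]
      using a b z finite_L
      by (intro k.finsum_cong') (auto simp: mult_A k.finsum_rdistr Pi_def intro!: k.finsum_closed)
    also have "\<dots> = (\<Oplus>g\<in>carrier L. \<Oplus>w\<in>carrier L.
        V z w \<otimes> (\<alpha> g (inv\<^bsub>L\<^esub> g \<otimes>\<^bsub>L\<^esub> w) \<otimes> (a g \<otimes> b (inv\<^bsub>L\<^esub> g \<otimes>\<^bsub>L\<^esub> w))))"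
      using a b z finite_L by (intro k.add.finprod_swap) auto
    also have "\<dots> = (\<Oplus>g\<in>carrier L. \<Oplus>h\<in>carrier L. ?P g h \<oplus> ?Q g h)"
    proof (rule k.finsum_cong'[OF refl])
      fix g assume g: "g \<in> carrier L"
      have "(\<Oplus>w\<in>carrier L.
          V z w \<otimes> (\<alpha> g (inv\<^bsub>L\<^esub> g \<otimes>\<^bsub>L\<^esub> w) \<otimes> (a g \<otimes> b (inv\<^bsub>L\<^esub> g \<otimes>\<^bsub>L\<^esub> w)))) =
        (\<Oplus>h\<in>carrier L. V z (g \<otimes>\<^bsub>L\<^esub> h) \<otimes>
          (\<alpha> g (inv\<^bsub>L\<^esub> g \<otimes>\<^bsub>L\<^esub> (g \<otimes>\<^bsub>L\<^esub> h)) \<otimes> (a g \<otimes> b (inv\<^bsub>L\<^esub> g \<otimes>\<^bsub>L\<^esub> (g \<otimes>\<^bsub>L\<^esub> h)))))"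
        using a b z g by (intro sum_left_translate) auto
      also have "\<dots> = (\<Oplus>h\<in>carrier L. V z (g \<otimes>\<^bsub>L\<^esub> h) \<otimes> \<alpha> g h \<otimes> (a g \<otimes> b h))"
        using a b z g by (intro k.finsum_cong') (auto simp: k.m_assoc)
      also have "\<dots> = (\<Oplus>h\<in>carrier L. ?P g h \<oplus> ?Q g h)"
        using a b z g by (intro k.finsum_cong') (auto simp: leibniz k.l_distr)
      finally show "(\<Oplus>w\<in>carrier L.
          V z w \<otimes> (\<alpha> g (inv\<^bsub>L\<^esub> g \<otimes>\<^bsub>L\<^esub> w) \<otimes> (a g \<otimes> b (inv\<^bsub>L\<^esub> g \<otimes>\<^bsub>L\<^esub> w)))) =
        (\<Oplus>h\<in>carrier L. ?P g h \<oplus> ?Q g h)" .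
    qed (use a b z in \<open>auto intro!: k.finsum_closed\<close>)
    also have "\<dots> = (\<Oplus>g\<in>carrier L. \<Oplus>h\<in>carrier L. ?P g h) \<oplus> (\<Oplus>g\<in>carrier L. \<Oplus>h\<in>carrier L. ?Q g h)"
    proof -
      have "(\<Oplus>h\<in>carrier L. ?P g h \<oplus> ?Q g h) = (\<Oplus>h\<in>carrier L. ?P g h) \<oplus> (\<Oplus>h\<in>carrier L. ?Q g h)"
        if "g \<in> carrier L" for g
        using a b z that by (intro k.finsum_addf) auto
      then have "(\<Oplus>g\<in>carrier L. \<Oplus>h\<in>carrier L. ?P g h \<oplus> ?Q g h) =
          (\<Oplus>g\<in>carrier L. (\<Oplus>h\<in>carrier L. ?P g h) \<oplus> (\<Oplus>h\<in>carrier L. ?Q g h))"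
        using a b z
        by (intro k.finsum_cong'[OF refl]) (auto intro!: k.finsum_closed k.a_closed)
      also have "\<dots> = (\<Oplus>g\<in>carrier L. \<Oplus>h\<in>carrier L. ?P g h) \<oplus> (\<Oplus>g\<in>carrier L. \<Oplus>h\<in>carrier L. ?Q g h)"
        using a b z by (intro k.finsum_addf) (auto intro!: k.finsum_closed)
      finally show ?thesis .
    qed
    also have "(\<Oplus>g\<in>carrier L. \<Oplus>h\<in>carrier L. ?P g h) = (D a \<otimes>\<^bsub>A\<^esub> b) z"
    proof -
      have "(D a \<otimes>\<^bsub>A\<^esub> b) z = (\<Oplus>h\<in>carrier L. \<alpha> (z \<otimes>\<^bsub>L\<^esub> inv\<^bsub>L\<^esub> h) (inv\<^bsub>L\<^esub> (z \<otimes>\<^bsub>L\<^esub> inv\<^bsub>L\<^esub> h) \<otimes>\<^bsub>L\<^esub> z) \<otimes>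
          (D a (z \<otimes>\<^bsub>L\<^esub> inv\<^bsub>L\<^esub> h) \<otimes> b (inv\<^bsub>L\<^esub> (z \<otimes>\<^bsub>L\<^esub> inv\<^bsub>L\<^esub> h) \<otimes>\<^bsub>L\<^esub> z)))"
        unfolding mult_A[OF z] using a b z D_closed
        by (intro sum_inverse_translate) auto
      also have "\<dots> = (\<Oplus>h\<in>carrier L. \<alpha> (z \<otimes>\<^bsub>L\<^esub> inv\<^bsub>L\<^esub> h) h \<otimes> (D a (z \<otimes>\<^bsub>L\<^esub> inv\<^bsub>L\<^esub> h) \<otimes> b h))"
        using a b z D_closed
        by (intro k.finsum_cong') (auto simp: L.inv_mult_group L.m_assoc)
      also have "\<dots> = (\<Oplus>h\<in>carrier L. \<Oplus>g\<in>carrier L. ?P g h)"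
      proof (rule k.finsum_cong'[OF refl])
        fix h assume h: "h \<in> carrier L"
        have "\<alpha> (z \<otimes>\<^bsub>L\<^esub> inv\<^bsub>L\<^esub> h) h \<otimes> (D a (z \<otimes>\<^bsub>L\<^esub> inv\<^bsub>L\<^esub> h) \<otimes> b h) =
          (\<Oplus>g\<in>carrier L. V (z \<otimes>\<^bsub>L\<^esub> inv\<^bsub>L\<^esub> h) g \<otimes> a g) \<otimes> (\<alpha> (z \<otimes>\<^bsub>L\<^esub> inv\<^bsub>L\<^esub> h) h \<otimes> b h)"
          using a b z h by (simp add: D k.m_ac Pi_def)
        also have "\<dots> = (\<Oplus>g\<in>carrier L. V (z \<otimes>\<^bsub>L\<^esub> inv\<^bsub>L\<^esub> h) g \<otimes> a g \<otimes> (\<alpha> (z \<otimes>\<^bsub>L\<^esub> inv\<^bsub>L\<^esub> h) h \<otimes> b h))"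
          using a b z h finite_L by (simp add: k.finsum_ldistr Pi_def)
        also have "\<dots> = (\<Oplus>g\<in>carrier L. ?P g h)"
          using a b z h by (intro k.finsum_cong') (auto simp: k.m_ac)
        finally show "\<alpha> (z \<otimes>\<^bsub>L\<^esub> inv\<^bsub>L\<^esub> h) h \<otimes> (D a (z \<otimes>\<^bsub>L\<^esub> inv\<^bsub>L\<^esub> h) \<otimes> b h) = (\<Oplus>g\<in>carrier L. ?P g h)" .
      qed (use a b z in \<open>auto intro!: k.finsum_closed\<close>)
      also have "\<dots> = (\<Oplus>g\<in>carrier L. \<Oplus>h\<in>carrier L. ?P g h)"
        using a b z finite_L by (intro k.add.finprod_swap) auto
      finally show ?thesis ..
    qed
    also have "(\<Oplus>g\<in>carrier L. \<Oplus>h\<in>carrier L. ?Q g h) = (a \<otimes>\<^bsub>A\<^esub> D b) z"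
      unfolding mult_A[OF z]
    proof (rule k.finsum_cong'[OF refl])
      fix g assume g: "g \<in> carrier L"
      have "\<alpha> g (inv\<^bsub>L\<^esub> g \<otimes>\<^bsub>L\<^esub> z) \<otimes> (a g \<otimes> D b (inv\<^bsub>L\<^esub> g \<otimes>\<^bsub>L\<^esub> z)) =
        (\<alpha> g (inv\<^bsub>L\<^esub> g \<otimes>\<^bsub>L\<^esub> z) \<otimes> a g) \<otimes> (\<Oplus>h\<in>carrier L. V (inv\<^bsub>L\<^esub> g \<otimes>\<^bsub>L\<^esub> z) h \<otimes> b h)"
        using a b z g by (simp add: D k.m_assoc Pi_def)
      also have "\<dots> = (\<Oplus>h\<in>carrier L. (\<alpha> g (inv\<^bsub>L\<^esub> g \<otimes>\<^bsub>L\<^esub> z) \<otimes> a g) \<otimes> (V (inv\<^bsub>L\<^esub> g \<otimes>\<^bsub>L\<^esub> z) h \<otimes> b h))"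
        using a b z g finite_L by (simp add: k.finsum_rdistr Pi_def)
      also have "\<dots> = (\<Oplus>h\<in>carrier L. ?Q g h)"
        using a b z g by (intro k.finsum_cong') (auto simp: k.m_ac)
      finally show "(\<Oplus>h\<in>carrier L. ?Q g h) =
        \<alpha> g (inv\<^bsub>L\<^esub> g \<otimes>\<^bsub>L\<^esub> z) \<otimes> (a g \<otimes> D b (inv\<^bsub>L\<^esub> g \<otimes>\<^bsub>L\<^esub> z))" ..
    qed (use a b z D_closed in auto)
    finally show "D (a \<otimes>\<^bsub>A\<^esub> b) z = ((D a \<otimes>\<^bsub>A\<^esub> b) \<oplus>\<^bsub>A\<^esub> (a \<otimes>\<^bsub>A\<^esub> D b)) z"
      using z by simp
  qed
  have "D \<in> carrier A \<rightarrow>\<^sub>E carrier A"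
    using D_closed by (auto simp: D_def)
  then show ?thesis
    using D_add D_smult D_mult by (simp add: derivations_def)
qed

end

section \<open>The derivation supported on a regular conjugacy class\<close>

lemma (in group) subgroup_centralizer:
  assumes x: "x \<in> carrier G"
  shows "subgroup (centralizer G x) G"
proof (rule subgroupI)
  show "centralizer G x \<subseteq> carrier G" by (auto simp: centralizer_def)
  show "centralizer G x \<noteq> {}" using x by (auto simp: centralizer_def intro!: exI[of _ \<one>])
next
  fix a b assume "a \<in> centralizer G x" "b \<in> centralizer G x"
  then have a: "a \<in> carrier G" "x \<otimes> a = a \<otimes> x" and b: "b \<in> carrier G" "x \<otimes> b = b \<otimes> x"
    by (auto simp: centralizer_def)
  have "x \<otimes> (a \<otimes> b) = a \<otimes> (x \<otimes> b)"
    using x a b(1) by (simp flip: m_assoc)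
  also have "\<dots> = a \<otimes> b \<otimes> x"
    using x a(1) b by (simp add: m_assoc)
  finally show "a \<otimes> b \<in> centralizer G x" using a(1) b(1) by (simp add: centralizer_def)
next
  fix a assume a: "a \<in> centralizer G x"
  then have a': "a \<in> carrier G" "a \<otimes> x = x \<otimes> a" by (auto simp: centralizer_def)
  have "a \<otimes> (x \<otimes> inv a) = a \<otimes> x \<otimes> inv a"
    using x a'(1) by (simp add: m_assoc)
  also have "\<dots> = x"
    using x a'(1) by (simp add: a'(2) m_assoc)
  finally have "a \<otimes> (x \<otimes> inv a) = x" .
  then have "x \<otimes> inv a = inv a \<otimes> x"
    using inv_solve_left[of "x \<otimes> inv a" a x] x a'(1) by simp
  then show "inv a \<in> centralizer G x" using a'(1) by (simp add: centralizer_def)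
qed

locale regular_element_hom = twisted_group k L \<alpha>
  for k :: "('k, 'm) ring_scheme" (structure) and L :: "('g, 'n) monoid_scheme" (structure)
    and \<alpha> :: "'g \<Rightarrow> 'g \<Rightarrow> 'k" +
  fixes x :: 'g and f :: "'g \<Rightarrow> 'k"
  assumes regular: "x \<in> regular_elements L \<alpha>"
    and f_hom: "f \<in> hom (L\<lparr>carrier := centralizer L x\<rparr>) (add_monoid k)"
begin

definition conj_class :: "'g set" where
  "conj_class = {y \<in> carrier L. \<exists>t \<in> carrier L. t \<otimes>\<^bsub>L\<^esub> x = y \<otimes>\<^bsub>L\<^esub> t}"

text \<open>An arbitrary but fixed \<open>t\<^sub>y\<close> with \<open>t\<^sub>y x t\<^sub>y\<^sup>-\<^sup>1 = y\<close>; these represent the cosets of the centralizer.\<close>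

definition transporter :: "'g \<Rightarrow> 'g" where
  "transporter y = (SOME t. t \<in> carrier L \<and> t \<otimes>\<^bsub>L\<^esub> x = y \<otimes>\<^bsub>L\<^esub> t)"

text \<open>The scalar \<open>\<lambda>\<^sub>y\<close> in \<open>e\<^sub>y = \<lambda>\<^sub>y [y]\<close>, where \<open>e\<^sub>y\<close> is the conjugate of \<open>[x]\<close> by the basis element of
  \<open>t\<^sub>y\<close>: compare the coefficients in \<open>[t] [x] = e\<^sub>y [t]\<close> for \<open>t = t\<^sub>y\<close>.\<close>

definition lift_coeff :: "'g \<Rightarrow> 'k" where
  "lift_coeff y = \<alpha> (transporter y) x \<otimes> inv (\<alpha> y (transporter y))"

text \<open>The coefficient of \<open>e\<^sub>y\<close> in the cocycle \<open>d(g)\<close> that corresponds to \<open>f\<close> under Shapiro's isomorphism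
  \<open>H\<^sup>1(L, k[L/C]) = Hom(C, k)\<close>.\<close>

definition shapiro_cocycle :: "'g \<Rightarrow> 'g \<Rightarrow> 'k" where
  "shapiro_cocycle g y =
    f (inv\<^bsub>L\<^esub> transporter y \<otimes>\<^bsub>L\<^esub> g \<otimes>\<^bsub>L\<^esub> transporter (inv\<^bsub>L\<^esub> g \<otimes>\<^bsub>L\<^esub> y \<otimes>\<^bsub>L\<^esub> g))"

text \<open>The coefficient of \<open>[z]\<close> in \<open>d(g) [g]\<close>: it comes from the term of \<open>d(g)\<close> at \<open>y = z g\<^sup>-\<^sup>1\<close>.\<close>

definition derivation_coeff :: "'g \<Rightarrow> 'g \<Rightarrow> 'k" where
  "derivation_coeff z g = (let y = z \<otimes>\<^bsub>L\<^esub> inv\<^bsub>L\<^esub> g in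
    if y \<in> conj_class then shapiro_cocycle g y \<otimes> (lift_coeff y \<otimes> \<alpha> y g) else \<zero>)"

lemma x_closed [simp]: "x \<in> carrier L"
  using regular by (simp add: regular_elements_def)

lemma conj_class_closed [simp]: "y \<in> conj_class \<Longrightarrow> y \<in> carrier L"
  by (simp add: conj_class_def)

lemma transporter:
  assumes "y \<in> conj_class"
  shows "transporter y \<in> carrier L" and "transporter y \<otimes>\<^bsub>L\<^esub> x = y \<otimes>\<^bsub>L\<^esub> transporter y"
proof -
  have "\<exists>t. t \<in> carrier L \<and> t \<otimes>\<^bsub>L\<^esub> x = y \<otimes>\<^bsub>L\<^esub> t"
    using assms unfolding conj_class_def by blast
  from someI_ex[OF this, folded transporter_def]
  show "transporter y \<in> carrier L" and "transporter y \<otimes>\<^bsub>L\<^esub> x = y \<otimes>\<^bsub>L\<^esub> transporter y"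
    by blast+
qed

lemma conj_class_conj:
  assumes y: "y \<in> conj_class" and g: "g \<in> carrier L" and y': "y' \<in> carrier L"
    and conj: "g \<otimes>\<^bsub>L\<^esub> y = y' \<otimes>\<^bsub>L\<^esub> g"
  shows "y' \<in> conj_class"
proof -
  let ?t = "transporter y"
  have "(g \<otimes>\<^bsub>L\<^esub> ?t) \<otimes>\<^bsub>L\<^esub> x = g \<otimes>\<^bsub>L\<^esub> y \<otimes>\<^bsub>L\<^esub> ?t"
    using g y transporter[OF y] by (simp add: L.m_assoc)
  also have "\<dots> = y' \<otimes>\<^bsub>L\<^esub> (g \<otimes>\<^bsub>L\<^esub> ?t)"
    using g y y' transporter[OF y] by (simp add: conj L.m_assoc)
  finally show ?thesis
    using g y' transporter[OF y] unfolding conj_class_def by blast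
qed

lemma x_conj_class: "x \<in> conj_class"
  unfolding conj_class_def by (rule CollectI, intro conjI bexI[of _ "\<one>\<^bsub>L\<^esub>"]) simp_all

lemma lift_coeff_unit: "y \<in> conj_class \<Longrightarrow> lift_coeff y \<in> Units k"
  unfolding lift_coeff_def by (intro k.Units_m_closed k.Units_inv_Units \<alpha>_unit transporter) auto

lemma lift_coeff_closed [simp]: "y \<in> conj_class \<Longrightarrow> lift_coeff y \<in> carrier k"
  using lift_coeff_unit by (rule k.Units_closed)

text \<open>Any element conjugating \<open>x\<close> to \<open>y\<close> gives the same \<open>e\<^sub>y\<close>. It differs from \<open>t\<^sub>y\<close> by some \<open>c\<close> in the
  centralizer of \<open>x\<close>, and regularity of \<open>x\<close> is exactly the statement that \<open>c\<close> fixes \<open>[x]\<close>.\<close>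

lemma lift_coeff_eq:
  assumes s: "s \<in> carrier L" and y: "y \<in> carrier L" and sx: "s \<otimes>\<^bsub>L\<^esub> x = y \<otimes>\<^bsub>L\<^esub> s"
  shows "\<alpha> s x = lift_coeff y \<otimes> \<alpha> y s"
proof -
  have yc: "y \<in> conj_class" using assms unfolding conj_class_def by blast
  define t where "t = transporter y"
  have t: "t \<in> carrier L" "t \<otimes>\<^bsub>L\<^esub> x = y \<otimes>\<^bsub>L\<^esub> t"
    unfolding t_def by (rule transporter[OF yc])+
  define c where "c = inv\<^bsub>L\<^esub> t \<otimes>\<^bsub>L\<^esub> s"
  have c: "c \<in> carrier L" and tc: "t \<otimes>\<^bsub>L\<^esub> c = s"
    using s t by (auto simp: c_def simp flip: L.m_assoc)
  have "t \<otimes>\<^bsub>L\<^esub> (c \<otimes>\<^bsub>L\<^esub> x) = t \<otimes>\<^bsub>L\<^esub> x \<otimes>\<^bsub>L\<^esub> c"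
    using t c y sx tc by (metis L.m_assoc x_closed)
  then have cx: "x \<otimes>\<^bsub>L\<^esub> c = c \<otimes>\<^bsub>L\<^esub> x"
    using t(1) c by (simp add: L.m_assoc)
  then have reg: "\<alpha> x c = \<alpha> c x"
    using regular c by (auto simp: regular_elements_def centralizer_def)
  have tx: "\<alpha> t x = lift_coeff y \<otimes> \<alpha> y t"
    using \<alpha>_unit[of y t] y t by (simp add: lift_coeff_def k.m_assoc flip: t_def)
  have "\<alpha> s x \<otimes> \<alpha> t c = \<alpha> t (x \<otimes>\<^bsub>L\<^esub> c) \<otimes> \<alpha> x c"
    using \<alpha>_cocycle[of t c x] t(1) c by (simp add: tc cx reg)
  also have "\<dots> = \<alpha> (y \<otimes>\<^bsub>L\<^esub> t) c \<otimes> (lift_coeff y \<otimes> \<alpha> y t)"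
    using \<alpha>_cocycle[of t x c] t c by (simp add: tx)
  also have "\<dots> = lift_coeff y \<otimes> (\<alpha> (y \<otimes>\<^bsub>L\<^esub> t) c \<otimes> \<alpha> y t)"
    using yc y t(1) c by (simp add: k.m_lcomm)
  also have "\<dots> = lift_coeff y \<otimes> \<alpha> y s \<otimes> \<alpha> t c"
    using \<alpha>_cocycle[of y t c] yc y t(1) c s by (simp add: tc k.m_assoc)
  finally show ?thesis
    by (rule \<alpha>_cancel[rotated 4]) (use t(1) c s y yc in simp_all)
qed

text \<open>This is \<open>[g] e\<^sub>y = e\<^sub>y\<^sub>' [g]\<close>: the group permutes the \<open>e\<^sub>y\<close>. If \<open>t\<close> conjugates \<open>x\<close> to \<open>y\<close>, then
  \<open>gt\<close> conjugates \<open>x\<close> to \<open>y'\<close>, and both can be used to compute the scalars.\<close>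

lemma lift_coeff_conj:
  assumes y: "y \<in> conj_class" and g: "g \<in> carrier L" and y': "y' \<in> carrier L"
    and conj: "g \<otimes>\<^bsub>L\<^esub> y = y' \<otimes>\<^bsub>L\<^esub> g"
  shows "lift_coeff y \<otimes> \<alpha> g y = lift_coeff y' \<otimes> \<alpha> y' g"
proof -
  define t where "t = transporter y"
  have t: "t \<in> carrier L" "t \<otimes>\<^bsub>L\<^esub> x = y \<otimes>\<^bsub>L\<^esub> t"
    unfolding t_def by (rule transporter[OF y])+
  have y'c: "y' \<in> conj_class" using conj_class_conj[OF assms] .
  have gt: "(g \<otimes>\<^bsub>L\<^esub> t) \<otimes>\<^bsub>L\<^esub> x = y' \<otimes>\<^bsub>L\<^esub> (g \<otimes>\<^bsub>L\<^esub> t)"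
    using t g y y' conj by (metis L.m_assoc x_closed conj_class_closed)
  have "lift_coeff y \<otimes> \<alpha> g y \<otimes> \<alpha> (g \<otimes>\<^bsub>L\<^esub> y) t = lift_coeff y \<otimes> (\<alpha> (g \<otimes>\<^bsub>L\<^esub> y) t \<otimes> \<alpha> g y)"
    using y g t(1) by (simp add: k.m_ac)
  also have "\<dots> = lift_coeff y \<otimes> (\<alpha> g (y \<otimes>\<^bsub>L\<^esub> t) \<otimes> \<alpha> y t)"
    using \<alpha>_cocycle[of g y t] y g t(1) by simp
  also have "\<dots> = \<alpha> g (t \<otimes>\<^bsub>L\<^esub> x) \<otimes> \<alpha> t x"
    using lift_coeff_eq[of t y] y g t by (simp add: k.m_lcomm)
  also have "\<dots> = \<alpha> (g \<otimes>\<^bsub>L\<^esub> t) x \<otimes> \<alpha> g t"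
    using \<alpha>_cocycle[of g t x] g t(1) by simp
  also have "\<dots> = lift_coeff y' \<otimes> (\<alpha> y' (g \<otimes>\<^bsub>L\<^esub> t) \<otimes> \<alpha> g t)"
    using lift_coeff_eq[OF _ y' gt] g t(1) y' y'c by (simp add: k.m_assoc)
  also have "\<dots> = lift_coeff y' \<otimes> (\<alpha> (g \<otimes>\<^bsub>L\<^esub> y) t \<otimes> \<alpha> y' g)"
    using \<alpha>_cocycle[of y' g t] g t(1) y' by (simp add: conj)
  also have "\<dots> = lift_coeff y' \<otimes> \<alpha> y' g \<otimes> \<alpha> (g \<otimes>\<^bsub>L\<^esub> y) t"
    using y g t(1) y' y'c by (simp add: k.m_ac)
  finally show ?thesis
    by (rule \<alpha>_cancel[rotated 4]) (use y g t(1) y' y'c in simp_all)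
qed

lemma transporter_quotient_in_centralizer:
  assumes y: "y \<in> conj_class" and y': "y' \<in> conj_class" and g: "g \<in> carrier L"
    and conj: "g \<otimes>\<^bsub>L\<^esub> y' = y \<otimes>\<^bsub>L\<^esub> g"
  shows "inv\<^bsub>L\<^esub> transporter y \<otimes>\<^bsub>L\<^esub> g \<otimes>\<^bsub>L\<^esub> transporter y' \<in> centralizer L x"
proof -
  define t t' where "t = transporter y" and "t' = transporter y'"
  have t: "t \<in> carrier L" "t \<otimes>\<^bsub>L\<^esub> x = y \<otimes>\<^bsub>L\<^esub> t" and t': "t' \<in> carrier L" "t' \<otimes>\<^bsub>L\<^esub> x = y' \<otimes>\<^bsub>L\<^esub> t'"
    unfolding t_def t'_def by (rule transporter[OF y] transporter[OF y'])+
  have "t \<otimes>\<^bsub>L\<^esub> (inv\<^bsub>L\<^esub> t \<otimes>\<^bsub>L\<^esub> g \<otimes>\<^bsub>L\<^esub> t' \<otimes>\<^bsub>L\<^esub> x) = g \<otimes>\<^bsub>L\<^esub> (t' \<otimes>\<^bsub>L\<^esub> x)"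
    using t(1) t'(1) g by (simp flip: L.m_assoc)
  also have "\<dots> = g \<otimes>\<^bsub>L\<^esub> y' \<otimes>\<^bsub>L\<^esub> t'"
    using t' g y' by (simp add: L.m_assoc)
  also have "\<dots> = y \<otimes>\<^bsub>L\<^esub> t \<otimes>\<^bsub>L\<^esub> (inv\<^bsub>L\<^esub> t \<otimes>\<^bsub>L\<^esub> g \<otimes>\<^bsub>L\<^esub> t')"
    using t(1) t'(1) g y by (simp add: conj L.m_assoc) (simp flip: L.m_assoc)
  also have "\<dots> = t \<otimes>\<^bsub>L\<^esub> (x \<otimes>\<^bsub>L\<^esub> (inv\<^bsub>L\<^esub> t \<otimes>\<^bsub>L\<^esub> g \<otimes>\<^bsub>L\<^esub> t'))"
    using t t' g y by (simp add: L.m_assoc flip: t(2))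
  finally have "x \<otimes>\<^bsub>L\<^esub> (inv\<^bsub>L\<^esub> t \<otimes>\<^bsub>L\<^esub> g \<otimes>\<^bsub>L\<^esub> t') = inv\<^bsub>L\<^esub> t \<otimes>\<^bsub>L\<^esub> g \<otimes>\<^bsub>L\<^esub> t' \<otimes>\<^bsub>L\<^esub> x"
    using t t' g by simp
  then show ?thesis
    using t t' g by (simp add: centralizer_def t_def t'_def)
qed

lemma f_closed [simp]: "c \<in> centralizer L x \<Longrightarrow> f c \<in> carrier k"
  using f_hom by (auto simp: hom_def)

lemma f_mult:
  "a \<in> centralizer L x \<Longrightarrow> b \<in> centralizer L x \<Longrightarrow> f (a \<otimes>\<^bsub>L\<^esub> b) = f a \<oplus> f b"
  using f_hom by (auto simp: hom_def)

lemma conj_inverse: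
  "g \<in> carrier L \<Longrightarrow> y \<in> carrier L \<Longrightarrow> g \<otimes>\<^bsub>L\<^esub> (inv\<^bsub>L\<^esub> g \<otimes>\<^bsub>L\<^esub> y \<otimes>\<^bsub>L\<^esub> g) = y \<otimes>\<^bsub>L\<^esub> g"
  by (simp flip: L.m_assoc)

lemma conj_class_conj_iff:
  assumes "g \<in> carrier L" "y \<in> carrier L"
  shows "inv\<^bsub>L\<^esub> g \<otimes>\<^bsub>L\<^esub> y \<otimes>\<^bsub>L\<^esub> g \<in> conj_class \<longleftrightarrow> y \<in> conj_class"
proof
  assume "inv\<^bsub>L\<^esub> g \<otimes>\<^bsub>L\<^esub> y \<otimes>\<^bsub>L\<^esub> g \<in> conj_class"
  then show "y \<in> conj_class"
    using assms(1,2) by (rule conj_class_conj) (simp add: conj_inverse assms)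
next
  assume "y \<in> conj_class"
  then show "inv\<^bsub>L\<^esub> g \<otimes>\<^bsub>L\<^esub> y \<otimes>\<^bsub>L\<^esub> g \<in> conj_class"
    using assms by (intro conj_class_conj[OF \<open>y \<in> conj_class\<close>, of "inv\<^bsub>L\<^esub> g"]) (auto simp: L.m_assoc)
qed

lemma shapiro_closed [simp]:
  assumes "g \<in> carrier L" "y \<in> conj_class"
  shows "shapiro_cocycle g y \<in> carrier k"
  unfolding shapiro_cocycle_def using assms
  by (intro f_closed transporter_quotient_in_centralizer)
    (auto simp: conj_class_conj_iff conj_inverse)

text \<open>The cocycle identity for \<open>d\<close>, read off at \<open>e\<^sub>y\<close>: insert \<open>t\<^sub>w t\<^sub>w\<^sup>-\<^sup>1\<close> with \<open>w = g\<^sup>-\<^sup>1yg\<close> between \<open>g\<close> and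
  \<open>h\<close>.\<close>

lemma shapiro_mult:
  assumes g: "g \<in> carrier L" and h: "h \<in> carrier L" and y: "y \<in> conj_class"
  shows "shapiro_cocycle (g \<otimes>\<^bsub>L\<^esub> h) y =
    shapiro_cocycle g y \<oplus> shapiro_cocycle h (inv\<^bsub>L\<^esub> g \<otimes>\<^bsub>L\<^esub> y \<otimes>\<^bsub>L\<^esub> g)"
proof -
  define y' where "y' = inv\<^bsub>L\<^esub> g \<otimes>\<^bsub>L\<^esub> y \<otimes>\<^bsub>L\<^esub> g"
  define y'' where "y'' = inv\<^bsub>L\<^esub> h \<otimes>\<^bsub>L\<^esub> y' \<otimes>\<^bsub>L\<^esub> h"
  have y': "y' \<in> conj_class" using g y by (simp add: y'_def conj_class_conj_iff)
  have y'': "y'' \<in> conj_class" using h y' by (simp add: y''_def conj_class_conj_iff)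
  have gy: "g \<otimes>\<^bsub>L\<^esub> y' = y \<otimes>\<^bsub>L\<^esub> g" and hy: "h \<otimes>\<^bsub>L\<^esub> y'' = y' \<otimes>\<^bsub>L\<^esub> h"
    using g h y y' by (simp_all add: y'_def y''_def conj_inverse)
  let ?t = transporter
  note t = transporter(1)[OF y] transporter(1)[OF y'] transporter(1)[OF y'']
  have "shapiro_cocycle (g \<otimes>\<^bsub>L\<^esub> h) y = f (inv\<^bsub>L\<^esub> ?t y \<otimes>\<^bsub>L\<^esub> (g \<otimes>\<^bsub>L\<^esub> h) \<otimes>\<^bsub>L\<^esub> ?t y'')"
    using g h y by (simp add: shapiro_cocycle_def y''_def y'_def L.inv_mult_group L.m_assoc)
  also have "inv\<^bsub>L\<^esub> ?t y \<otimes>\<^bsub>L\<^esub> (g \<otimes>\<^bsub>L\<^esub> h) \<otimes>\<^bsub>L\<^esub> ?t y'' =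
      (inv\<^bsub>L\<^esub> ?t y \<otimes>\<^bsub>L\<^esub> g \<otimes>\<^bsub>L\<^esub> ?t y') \<otimes>\<^bsub>L\<^esub> (inv\<^bsub>L\<^esub> ?t y' \<otimes>\<^bsub>L\<^esub> h \<otimes>\<^bsub>L\<^esub> ?t y'')"
  proof -
    have "?t y' \<otimes>\<^bsub>L\<^esub> (inv\<^bsub>L\<^esub> ?t y' \<otimes>\<^bsub>L\<^esub> (h \<otimes>\<^bsub>L\<^esub> ?t y'')) = h \<otimes>\<^bsub>L\<^esub> ?t y''"
      using t h by (simp flip: L.m_assoc)
    then show ?thesis using t g h by (simp add: L.m_assoc)
  qed
  also have "f \<dots> = f (inv\<^bsub>L\<^esub> ?t y \<otimes>\<^bsub>L\<^esub> g \<otimes>\<^bsub>L\<^esub> ?t y') \<oplus> f (inv\<^bsub>L\<^esub> ?t y' \<otimes>\<^bsub>L\<^esub> h \<otimes>\<^bsub>L\<^esub> ?t y'')"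
    by (intro f_mult transporter_quotient_in_centralizer y y' y'' g h gy hy)
  finally show ?thesis
    by (simp add: shapiro_cocycle_def flip: y'_def y''_def)
qed

text \<open>Here \<open>t\<^sub>x\<close> need not be 1, but it lies in the centralizer of \<open>x\<close>, and \<open>f\<close> is invariant under
  conjugation because its target is commutative.\<close>

lemma shapiro_centralizer:
  assumes c: "c \<in> centralizer L x"
  shows "shapiro_cocycle c x = f c"
proof -
  define t where "t = transporter x"
  have t: "t \<in> centralizer L x"
    using transporter[OF x_conj_class] by (simp add: t_def centralizer_def)
  interpret C: group "L\<lparr>carrier := centralizer L x\<rparr>"
    using L.subgroup_centralizer by (simp add: L.subgroup_imp_group)
  have inv_t: "inv\<^bsub>L\<^esub> t \<in> centralizer L x"
    using L.subgroup_centralizer[OF x_closed] t by (rule subgroup.m_inv_closed)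
  have carr: "c \<in> carrier L" "t \<in> carrier L" and cx: "x \<otimes>\<^bsub>L\<^esub> c = c \<otimes>\<^bsub>L\<^esub> x"
    using c t by (auto simp: centralizer_def)
  have "inv\<^bsub>L\<^esub> c \<otimes>\<^bsub>L\<^esub> x \<otimes>\<^bsub>L\<^esub> c = x"
    using carr by (simp add: L.m_assoc cx)
  then have "shapiro_cocycle c x = f (inv\<^bsub>L\<^esub> t \<otimes>\<^bsub>L\<^esub> c \<otimes>\<^bsub>L\<^esub> t)"
    by (simp add: shapiro_cocycle_def t_def)
  also have "\<dots> = f (inv\<^bsub>L\<^esub> t) \<oplus> f c \<oplus> f t"
    using c t inv_t C.m_closed by (simp add: f_mult)
  also have "\<dots> = f (t \<otimes>\<^bsub>L\<^esub> (inv\<^bsub>L\<^esub> t \<otimes>\<^bsub>L\<^esub> c))"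
    using c t inv_t C.m_closed by (simp add: f_mult k.a_ac)
  also have "\<dots> = f c"
    using carr by (simp flip: L.m_assoc)
  finally show ?thesis .
qed

lemma derivation_coeff_closed:
  "z \<in> carrier L \<Longrightarrow> g \<in> carrier L \<Longrightarrow> derivation_coeff z g \<in> carrier k"
  by (simp add: derivation_coeff_def Let_def)

text \<open>The two terms on the right are \<open>f\<close>-values times one common factor, the coefficient of \<open>[z]\<close> in
  \<open>e\<^sub>y [g] [h]\<close> with \<open>y = z (gh)\<^sup>-\<^sup>1\<close>: directly for the first, and after moving \<open>[g]\<close> past \<open>e\<^sub>y\<^sub>'\<close>, where
  \<open>y' = g\<^sup>-\<^sup>1yg\<close>, for the second. The \<open>f\<close>-values add up by \<open>shapiro_mult\<close>.\<close>

lemma derivation_coeff_leibniz: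
  assumes z: "z \<in> carrier L" and g: "g \<in> carrier L" and h: "h \<in> carrier L"
  shows "derivation_coeff z (g \<otimes>\<^bsub>L\<^esub> h) \<otimes> \<alpha> g h =
    \<alpha> (z \<otimes>\<^bsub>L\<^esub> inv\<^bsub>L\<^esub> h) h \<otimes> derivation_coeff (z \<otimes>\<^bsub>L\<^esub> inv\<^bsub>L\<^esub> h) g \<oplus>
    \<alpha> g (inv\<^bsub>L\<^esub> g \<otimes>\<^bsub>L\<^esub> z) \<otimes> derivation_coeff (inv\<^bsub>L\<^esub> g \<otimes>\<^bsub>L\<^esub> z) h"
proof -
  define y where "y = z \<otimes>\<^bsub>L\<^esub> inv\<^bsub>L\<^esub> (g \<otimes>\<^bsub>L\<^esub> h)"
  define y' where "y' = inv\<^bsub>L\<^esub> g \<otimes>\<^bsub>L\<^esub> y \<otimes>\<^bsub>L\<^esub> g"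
  have y: "y \<in> carrier L" and y': "y' \<in> carrier L" using z g h by (auto simp: y_def y'_def)
  have zh: "z \<otimes>\<^bsub>L\<^esub> inv\<^bsub>L\<^esub> h = y \<otimes>\<^bsub>L\<^esub> g"
    using z g h by (simp add: y_def L.inv_mult_group L.m_assoc)
  have gz: "inv\<^bsub>L\<^esub> g \<otimes>\<^bsub>L\<^esub> z = y' \<otimes>\<^bsub>L\<^esub> h"
    using z g h by (simp add: y_def y'_def L.inv_mult_group L.m_assoc)
  have yg: "y \<otimes>\<^bsub>L\<^esub> g \<otimes>\<^bsub>L\<^esub> inv\<^bsub>L\<^esub> g = y" and y'h: "y' \<otimes>\<^bsub>L\<^esub> h \<otimes>\<^bsub>L\<^esub> inv\<^bsub>L\<^esub> h = y'"
    using y y' g h by (simp_all add: L.m_assoc)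
  have conj: "g \<otimes>\<^bsub>L\<^esub> y' = y \<otimes>\<^bsub>L\<^esub> g" using y g by (simp add: y'_def conj_inverse)
  have iff: "y' \<in> conj_class \<longleftrightarrow> y \<in> conj_class"
    using y g by (simp add: y'_def conj_class_conj_iff)
  show ?thesis
  proof (cases "y \<in> conj_class")
    case False
    then show ?thesis
      using iff y y' g h
      by (simp add: derivation_coeff_def zh gz yg y'h flip: y_def)
  next
    case True
    then have yc: "y \<in> conj_class" and y'c: "y' \<in> conj_class" using iff by auto
    note c [simp] = yc y'c y y' g h
    \<comment> \<open>The coefficient of \<open>[z]\<close> in \<open>e\<^sub>y [g] [h]\<close>.\<close>
    let ?w = "lift_coeff y \<otimes> (\<alpha> y (g \<otimes>\<^bsub>L\<^esub> h) \<otimes> \<alpha> g h)"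
    let ?s = "shapiro_cocycle g y" and ?s' = "shapiro_cocycle h y'"
    have fst: "\<alpha> (y \<otimes>\<^bsub>L\<^esub> g) h \<otimes> (?s \<otimes> (lift_coeff y \<otimes> \<alpha> y g)) = ?s \<otimes> ?w"
    proof -
      have "\<alpha> (y \<otimes>\<^bsub>L\<^esub> g) h \<otimes> (?s \<otimes> (lift_coeff y \<otimes> \<alpha> y g)) =
          ?s \<otimes> (lift_coeff y \<otimes> (\<alpha> (y \<otimes>\<^bsub>L\<^esub> g) h \<otimes> \<alpha> y g))"
        by (simp add: k.m_ac)
      then show ?thesis using \<alpha>_cocycle[of y g h] by simp
    qed
    have snd: "\<alpha> g (y' \<otimes>\<^bsub>L\<^esub> h) \<otimes> (?s' \<otimes> (lift_coeff y' \<otimes> \<alpha> y' h)) = ?s' \<otimes> ?w"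
    proof -
      have "\<alpha> g (y' \<otimes>\<^bsub>L\<^esub> h) \<otimes> (?s' \<otimes> (lift_coeff y' \<otimes> \<alpha> y' h)) =
          ?s' \<otimes> (lift_coeff y' \<otimes> (\<alpha> g (y' \<otimes>\<^bsub>L\<^esub> h) \<otimes> \<alpha> y' h))"
        by (simp add: k.m_ac)
      also have "\<dots> = ?s' \<otimes> (lift_coeff y' \<otimes> (\<alpha> (y \<otimes>\<^bsub>L\<^esub> g) h \<otimes> \<alpha> g y'))"
        using \<alpha>_cocycle[of g y' h] by (simp add: conj)
      also have "\<dots> = ?s' \<otimes> ((lift_coeff y' \<otimes> \<alpha> g y') \<otimes> \<alpha> (y \<otimes>\<^bsub>L\<^esub> g) h)"
        by (simp add: k.m_ac)
      also have "lift_coeff y' \<otimes> \<alpha> g y' = lift_coeff y \<otimes> \<alpha> y g"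
        using lift_coeff_conj[OF y'c g y conj] .
      also have "?s' \<otimes> (lift_coeff y \<otimes> \<alpha> y g \<otimes> \<alpha> (y \<otimes>\<^bsub>L\<^esub> g) h) =
          ?s' \<otimes> (lift_coeff y \<otimes> (\<alpha> (y \<otimes>\<^bsub>L\<^esub> g) h \<otimes> \<alpha> y g))"
        by (simp add: k.m_ac)
      finally show ?thesis using \<alpha>_cocycle[of y g h] by simp
    qed
    have "derivation_coeff z (g \<otimes>\<^bsub>L\<^esub> h) \<otimes> \<alpha> g h = (?s \<oplus> ?s') \<otimes> ?w"
      using shapiro_mult[OF g h yc]
      by (simp add: derivation_coeff_def k.m_assoc flip: y_def y'_def)
    also have "\<dots> = ?s \<otimes> ?w \<oplus> ?s' \<otimes> ?w"
      by (simp add: k.l_distr)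
    finally show ?thesis
      by (simp add: derivation_coeff_def zh gz yg y'h fst snd)
  qed
qed

definition class_derivation :: "('g \<Rightarrow> 'k) \<Rightarrow> 'g \<Rightarrow> 'k" where
  "class_derivation =
    (\<lambda>a \<in> carrier A. \<lambda>z \<in> carrier L. \<Oplus>g\<in>carrier L. derivation_coeff z g \<otimes> a g)"

lemma class_derivation: "class_derivation \<in> derivations k A"
  unfolding class_derivation_def
  by (intro linear_extension_derivation derivation_coeff_closed derivation_coeff_leibniz)

lemma class_derivation_basis:
  assumes z: "z \<in> carrier L" and c: "c \<in> carrier L"
  shows "class_derivation (basis_element k L c) z = derivation_coeff z c"
proof -
  have "class_derivation (basis_element k L c) z =
      (\<Oplus>g\<in>carrier L. derivation_coeff z g \<otimes> basis_element k L c g)"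
    using z c by (simp add: class_derivation_def basis_closed)
  also have "\<dots> = (\<Oplus>g\<in>carrier L. if c = g then derivation_coeff z g else \<zero>)"
    using z c by (intro k.finsum_cong') (auto simp: basis_element_def derivation_coeff_closed)
  also have "\<dots> = derivation_coeff z c"
    using k.add.finprod_singleton[OF c finite_L, of "derivation_coeff z"] z
    by (simp add: derivation_coeff_closed)
  finally show ?thesis .
qed

text \<open>For \<open>c\<close> in the centralizer compare the coefficients at \<open>xc = cx\<close>. A commutator of \<open>a\<close> with \<open>[c]\<close> has
  there \<open>a(x) (\<alpha>(x,c) - \<alpha>(c,x))\<close>, which vanishes by regularity.\<close>

lemma class_derivation_inner_imp_zero:
  assumes inner: "class_derivation \<in> inner_derivations A" and c: "c \<in> centralizer L x"
  shows "f c = \<zero>"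
proof -
  let ?c = "basis_element k L c"
  have cL [simp]: "c \<in> carrier L" and cx: "x \<otimes>\<^bsub>L\<^esub> c = c \<otimes>\<^bsub>L\<^esub> x"
    using c by (auto simp: centralizer_def)
  have reg: "\<alpha> x c = \<alpha> c x" using regular c by (simp add: regular_elements_def)
  note x_conj_class [simp]
  obtain a where a: "a \<in> carrier A"
    and D: "class_derivation = (\<lambda>b \<in> carrier A. (a \<otimes>\<^bsub>A\<^esub> b) \<ominus>\<^bsub>A\<^esub> (b \<otimes>\<^bsub>A\<^esub> a))"
    using inner by (auto simp: inner_derivations_def)
  have "f c \<otimes> (lift_coeff x \<otimes> \<alpha> x c) = derivation_coeff (x \<otimes>\<^bsub>L\<^esub> c) c"
    using c by (simp add: derivation_coeff_def shapiro_centralizer L.m_assoc)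
  also have "\<dots> = class_derivation ?c (x \<otimes>\<^bsub>L\<^esub> c)"
    by (simp add: class_derivation_basis)
  also have "\<dots> = (a \<otimes>\<^bsub>A\<^esub> ?c) (x \<otimes>\<^bsub>L\<^esub> c) \<ominus> (?c \<otimes>\<^bsub>A\<^esub> a) (x \<otimes>\<^bsub>L\<^esub> c)"
    using a by (simp add: D basis_closed minus_A mult_A_closed)
  also have "\<dots> = \<alpha> x c \<otimes> a x \<ominus> \<alpha> c x \<otimes> a x"
    using mult_basis_right[OF a, of x c] mult_basis_left[OF a, of x c] by (simp add: cx)
  also have "\<dots> = \<zero>"
    using a by (simp add: reg k.minus_eq k.r_neg)
  finally have "f c \<otimes> (lift_coeff x \<otimes> \<alpha> x c) = \<zero>" .
  moreover have "lift_coeff x \<otimes> \<alpha> x c \<in> Units k"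
    by (intro k.Units_m_closed lift_coeff_unit \<alpha>_unit) auto
  ultimately show ?thesis
    using c k.integral_iff k.field_Units by auto
qed

end

section \<open>Nonvanishing of the first Hochschild cohomology\<close>

theorem theorem1p2:
  fixes k :: "('k, 'm) ring_scheme"
    and L :: "('g, 'n) monoid_scheme"
    and \<alpha> :: "'g \<Rightarrow> 'g \<Rightarrow> 'k"
    and p :: nat
  assumes "algebraically_closed k"
    and "Factorial_Ring.prime p"
    and "ring_characteristic k = p"
    and "group L"
    and "finite (carrier L)"
    and "p dvd order L"
    and "\<alpha> \<in> two_cocycles L (units_of k)"
    and "normalized_cocycle L (units_of k) \<alpha>"
    and "centralizer_p_elements L p \<inter> regular_elements L \<alpha> \<noteq> {}"
  shows "carrier (HH1 k (twisted_group_algebra k L \<alpha>))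
           \<noteq> {\<zero>\<^bsub>HH1 k (twisted_group_algebra k L \<alpha>)\<^esub>}"
proof
  interpret k: field k using assms(1) by (rule algebraically_closed.axioms)
  interpret L: group L by fact
  interpret T: twisted_group k L \<alpha> by unfold_locales fact+
  obtain x where x: "x \<in> carrier L" "x \<in> regular_elements L \<alpha>"
    and dvd: "p dvd abelianization_index L (centralizer L x)"
    using assms(9) by (auto simp: centralizer_p_elements_def)
  have C: "subgroup (centralizer L x) L" using x(1) by (rule L.subgroup_centralizer)
  have fin: "finite (centralizer L x)" using assms(5) by (simp add: centralizer_def)
  have one: "\<one>\<^bsub>k\<^esub> \<in> carrier (add_monoid k)" by simp
  \<comment> \<open>Additively, 1 has order \<open>p\<close>, so it can serve as a value of a homomorphism on the centralizer.\<close>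
  have "\<one>\<^bsub>k\<^esub> [^]\<^bsub>add_monoid k\<^esub> p = \<one>\<^bsub>add_monoid k\<^esub>"
    using assms(3) k.add.pow_ord_eq_1[of "\<one>\<^bsub>k\<^esub>"] by (auto simp: ring_characteristic_def add_pow_def)
  then obtain f where f: "f \<in> hom (L\<lparr>carrier := centralizer L x\<rparr>) (add_monoid k)"
    and "\<one>\<^bsub>k\<^esub> \<in> f ` centralizer L x"
    using L.hom_of_dvd_abelianization_index[OF C fin assms(2) dvd k.add.is_group one] by blast
  then obtain c where c: "c \<in> centralizer L x" "f c = \<one>\<^bsub>k\<^esub>" by auto
  interpret R: regular_element_hom k L \<alpha> x f by unfold_locales (rule x(2), rule f)
  assume "carrier (HH1 k (twisted_group_algebra k L \<alpha>)) =
    {\<zero>\<^bsub>HH1 k (twisted_group_algebra k L \<alpha>)\<^esub>}"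
  then have "R.class_derivation \<in> inner_derivations (twisted_group_algebra k L \<alpha>)"
    by (rule trivial_HH1_imp_inner[OF T.abelian_group_A T.zero_inner _ R.class_derivation])
  then have "f c = \<zero>\<^bsub>k\<^esub>" using c(1) by (rule R.class_derivation_inner_imp_zero)
  then show False using c(2) by simp
qed

end
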